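(* For each $n\ge 1$ let $f(n)$ be an integer such that the class $\mathcal{G}_n$ of all $n$-vertex graphs has a distance-vector labelling scheme with labels of at most $f(n)$ bits. Then $f(n)\ge (1-o(1))n$ as $n\to\infty$.
   Context: $d_G(u,v)$ is the distance in $G$ (possibly $\infty$). A distance-vector labelling scheme for a class $\mathcal{C}$ with labels of at most $k$ bits is a function $D:\{0,1\}^*\to(\mathbb{N}\cup\{\infty\})^*$ (from finite binary strings to finite sequences over $\mathbb{N}\cup\{\infty\}$) such that for every $G\in\mathcal{C}$ there exist an ordering $v_1,\dots,v_n$ of $V(G)$ and a function $\ell_G:V(G)\to\{0,1\}^*$ with $|\ell_G(v)|\le k$ for all $v$, such that $D(\ell_G(v))=(d_G(v,v_1),\dots,d_G(v,v_n))$ for every $v\in V(G)$. *)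

theory Defs
  imports
    Complex_Main
    "HOL-Library.Extended_Nat"
    "HOL-Library.Infinite_Typeclass"
    "HOL-Library.Landau_Symbols"
    "Graph_Theory.Graph_Theory"
begin

text \<open>
  A finite simple undirected graph is a \<^locale>\<open>pair_graph\<close>: a finite, symmetric and loopfree
  set of ordered pairs of vertices, each undirected edge being present in both orientations.
\<close>

definition n_vertex_graphs :: "nat \<Rightarrow> 'a pair_pre_digraph set" where
  "n_vertex_graphs n = {G. pair_graph G \<and> card (pverts G) = n}"

text \<open>If no walk joins the two vertices, the infimum is over the empty set and equals \<open>\<infinity>\<close>.\<close>

definition graph_dist :: "'a pair_pre_digraph \<Rightarrow> 'a \<Rightarrow> 'a \<Rightarrow> enat" where
  "graph_dist G u v = (INF p \<in> {p. pre_digraph.awalk (with_proj G) u p v}. enat (length p))"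

text \<open>
  The decoder \<open>D\<close> is common to the whole class and sees only a label, whereas the ordering
  \<open>vs\<close> and the labelling \<open>l\<close> may depend on the graph.
\<close>

definition has_distance_vector_scheme :: "'a pair_pre_digraph set \<Rightarrow> int \<Rightarrow> bool" where
  "has_distance_vector_scheme C k \<longleftrightarrow>
    (\<exists>D :: bool list \<Rightarrow> enat list.
      \<forall>G\<in>C. \<exists>(vs :: 'a list) (l :: 'a \<Rightarrow> bool list).
        distinct vs \<and> set vs = pverts G \<and>
        (\<forall>v\<in>pverts G. int (length (l v)) \<le> k) \<and>
        (\<forall>v\<in>pverts G. D (l v) = map (graph_dist G v) vs))"

end

theory Submission
  imports Defs "HOL-Real_Asymp.Real_Asymp" "HOL-Combinatorics.Multiset_Permutations"
begin

text \<open>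
  Split the vertices into a set \<open>A\<close> of about \<open>\<surd>n\<close> vertices and its complement \<open>B\<close>, and consider
  only the bipartite graphs between \<open>A\<close> and \<open>B\<close>. Such a graph is determined by the ordering of the
  vertices together with the labels of the vertices in \<open>A\<close>, since these labels yield the rows of
  the distance matrix indexed by \<open>A\<close>. Hence \<open>2 ^ (|A| |B|) \<le> n! (2 ^ (k + 1)) ^ |A|\<close>, where \<open>k\<close> is
  the label length. The factor \<open>n!\<close> costs only \<open>n log n / |A| = o(n)\<close> bits per label.
\<close>

text \<open>\<open>E\<close> lists each edge once, directed from \<open>A\<close> to
  \<open>V - A\<close>; the converse supplies the symmetry required of a \<open>pair_graph\<close>.
  It adds no pair from \<open>A\<close> to \<open>V - A\<close>, so \<open>E\<close> can be
  recovered from the arcs.\<close>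

definition bipartite_graph :: "'a set \<Rightarrow> ('a \<times> 'a) set \<Rightarrow> 'a pair_pre_digraph" where
  "bipartite_graph V E = \<lparr>pverts = V, parcs = E \<union> E\<inverse>\<rparr>"

lemma bipartite_graph_in_n_vertex_graphs:
  assumes "finite V" "A \<subseteq> V" "E \<subseteq> A \<times> (V - A)"
  shows "bipartite_graph V E \<in> n_vertex_graphs (card V)"
proof -
  have "finite E"
    using assms by (meson finite_Diff finite_SigmaI finite_subset)
  then have "pair_graph (bipartite_graph V E)"
    using assms
    by unfold_locales
      (auto simp: bipartite_graph_def arcs_ends_def arc_to_ends_def symmetric_def intro!: symI)
  then show ?thesis
    by (simp add: n_vertex_graphs_def bipartite_graph_def)
qed

text \<open>A strict upper bound on an infimum is witnessed by a single walk. One with fewer than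
  two arcs is empty, which \<open>u \<noteq> v\<close> excludes, or a single arc.\<close>

lemma (in pair_wf_digraph) graph_dist_less_2_iff:
  assumes "u \<in> pverts G" "u \<noteq> v"
  shows "graph_dist G u v < 2 \<longleftrightarrow> (u, v) \<in> parcs G"
proof
  assume "graph_dist G u v < 2"
  then obtain p where p: "awalk u p v" "enat (length p) < enat 2"
    unfolding graph_dist_def INF_less_iff numeral_eq_enat by auto
  then have "length p < 2"
    by simp
  then consider "p = []" | e where "p = [e]"
    by (cases p; cases "tl p") auto
  then show "(u, v) \<in> parcs G"
  proof cases
    case 1
    with p assms show ?thesis
      by (simp add: awalk_Nil_iff)
  next
    case 2
    with p show ?thesis
      by (cases e) (auto simp: awalk_Cons_iff awalk_Nil_iff)
  qed
next
  assume "(u, v) \<in> parcs G"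
  then have "awalk u [(u, v)] v"
    using arc_implies_awalk[of "(u, v)"] by simp
  then have "graph_dist G u v \<le> enat (length [(u, v)])"
    unfolding graph_dist_def by (intro INF_lower) auto
  also have "\<dots> < 2"
    by (simp add: numeral_eq_enat)
  finally show "graph_dist G u v < 2" .
qed

lemma card_bool_lists_length_le: "card {xs :: bool list. length xs \<le> k} < 2 ^ Suc k"
proof -
  have "card {xs :: bool list. length xs \<le> k} = (\<Sum>i\<le>k. 2 ^ i)"
    using card_lists_length_le[of "UNIV :: bool set" k] by simp
  also have "\<dots> < 2 ^ Suc k"
    by (induction k) auto
  finally show ?thesis .
qed

lemma finite_bool_lists_length_le: "finite {xs :: bool list. length xs \<le> k}"
  using finite_lists_length_le[of "UNIV :: bool set" k] by simp

lemma distance_vector_scheme_nonneg: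
  assumes "has_distance_vector_scheme C k" "G \<in> C" "pverts G \<noteq> {}"
  shows "0 \<le> k"
  using assms unfolding has_distance_vector_scheme_def
  by (metis all_not_in_conv of_nat_0_le_iff order_trans)

lemma bipartite_counting:
  fixes V :: "'a set"
  assumes scheme: "has_distance_vector_scheme (n_vertex_graphs (card V) :: 'a pair_pre_digraph set) k"
    and V: "finite V" and A: "A \<subseteq> V"
  shows "(2::nat) ^ (card A * card (V - A)) \<le> fact (card V) * (2 ^ Suc (nat k)) ^ card A"
proof -
  define L where "L = {xs :: bool list. length xs \<le> nat k}"
  have fin: "finite A" "finite (V - A)" "finite L"
    using V A finite_subset finite_bool_lists_length_le by (auto simp: L_def)
  obtain D :: "bool list \<Rightarrow> enat list" where D: "\<And>G :: 'a pair_pre_digraph. G \<in> n_vertex_graphs (card V) \<Longrightarrow>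
      \<exists>vs l. distinct vs \<and> set vs = pverts G \<and> (\<forall>v\<in>pverts G. int (length (l v)) \<le> k)
        \<and> (\<forall>v\<in>pverts G. D (l v) = map (graph_dist G v) vs)"
    using scheme unfolding has_distance_vector_scheme_def by blast
  \<comment> \<open>A graph may have many codes, so this is a relation from which \<open>c\<close>
    selects one. Extensional functions on \<open>A\<close> make the label assignments finite in
    number, at most \<open>card L ^ card A\<close>.\<close>
  define code where "code E p \<longleftrightarrow> fst p \<in> permutations_of_set V \<and> snd p \<in> A \<rightarrow>\<^sub>E L \<and>
      (\<forall>a\<in>A. D (snd p a) = map (graph_dist (bipartite_graph V E) a) (fst p))" for E p
  have "\<exists>p. code E p" if E: "E \<in> Pow (A \<times> (V - A))" for E
  proof -
    have "bipartite_graph V E \<in> n_vertex_graphs (card V)"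
      using bipartite_graph_in_n_vertex_graphs[OF V A] E by blast
    from D[OF this] obtain vs l where vs: "distinct vs" "set vs = V"
      and k: "\<And>v. v \<in> V \<Longrightarrow> int (length (l v)) \<le> k"
      and l: "\<And>v. v \<in> V \<Longrightarrow> D (l v) = map (graph_dist (bipartite_graph V E) v) vs"
      by (auto simp: bipartite_graph_def)
    have "l a \<in> L" if "a \<in> A" for a
      using k[of a] that A by (auto simp: L_def)
    moreover have "D (l a) = map (graph_dist (bipartite_graph V E) a) vs" if "a \<in> A" for a
      using l that A by blast
    ultimately have "code E (vs, restrict l A)"
      using vs by (simp add: code_def permutations_of_set_def)
    then show ?thesis ..
  qed
  then obtain c where c: "\<And>E. E \<in> Pow (A \<times> (V - A)) \<Longrightarrow> code E (c E)"
    by metis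
  \<comment> \<open>The right-hand side depends on \<open>p\<close> alone: find \<open>b\<close> in
    the ordering and inspect that entry of the vector decoded from the label of \<open>a\<close>.
    Hence equal codes force equal edge sets.\<close>
  have decode: "(a, b) \<in> E \<longleftrightarrow> (\<exists>i < length (fst p). fst p ! i = b \<and> D (snd p a) ! i < 2)"
    if "E \<in> Pow (A \<times> (V - A))" "code E p" "a \<in> A" "b \<in> V - A" for E p a b
  proof -
    have "pair_graph (bipartite_graph V E)"
      using bipartite_graph_in_n_vertex_graphs[OF V A] that by (auto simp: n_vertex_graphs_def)
    then interpret pair_graph "bipartite_graph V E" .
    have "graph_dist (bipartite_graph V E) a b < 2 \<longleftrightarrow> (a, b) \<in> E"
      using graph_dist_less_2_iff[of a b] that A by (auto simp: bipartite_graph_def)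
    moreover have "b \<in> set (fst p)"
      using that by (auto simp: code_def permutations_of_set_def)
    ultimately show ?thesis
      using that by (auto simp: code_def in_set_conv_nth)
  qed
  have "inj_on c (Pow (A \<times> (V - A)))"
  proof (rule inj_onI)
    fix E E' assume E: "E \<in> Pow (A \<times> (V - A))" "E' \<in> Pow (A \<times> (V - A))" "c E = c E'"
    have "(a, b) \<in> E \<longleftrightarrow> (a, b) \<in> E'" if "a \<in> A" "b \<in> V - A" for a b
      using decode[OF E(1) c[OF E(1)] that] decode[OF E(2) c[OF E(2)] that] E(3) by simp
    then show "E = E'"
      using E(1,2) by auto
  qed
  moreover have "c ` Pow (A \<times> (V - A)) \<subseteq> permutations_of_set V \<times> (A \<rightarrow>\<^sub>E L)"
  proof (rule image_subsetI)
    fix E assume "E \<in> Pow (A \<times> (V - A))"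
    from c[OF this] show "c E \<in> permutations_of_set V \<times> (A \<rightarrow>\<^sub>E L)"
      unfolding code_def mem_Times_iff by blast
  qed
  moreover have "finite (permutations_of_set V \<times> (A \<rightarrow>\<^sub>E L))"
    using V fin by (intro finite_cartesian_product finite_PiE) auto
  ultimately have "card (Pow (A \<times> (V - A))) \<le> card (permutations_of_set V \<times> (A \<rightarrow>\<^sub>E L))"
    by (rule card_inj_on_le)
  also have "\<dots> = fact (card V) * card L ^ card A"
    using V fin by (simp add: card_cartesian_product card_PiE)
  also have "\<dots> \<le> fact (card V) * (2 ^ Suc (nat k)) ^ card A"
    unfolding L_def by (intro mult_left_mono power_mono less_imp_le[OF card_bool_lists_length_le]) auto
  finally show ?thesis
    using fin by (simp add: card_Pow card_cartesian_product)
qed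

text \<open>Take binary logarithms in the counting bound with \<open>card A = m\<close>, use
  \<open>fact n \<le> n ^ n\<close>, and divide by \<open>m\<close>. The \<open>- 1\<close> arises
  because labels of length at most \<open>k\<close> number almost
  \<open>2 ^ (k + 1)\<close>.\<close>

lemma distance_vector_scheme_lower_bound:
  assumes scheme: "has_distance_vector_scheme (n_vertex_graphs n :: 'a::infinite pair_pre_digraph set) k"
    and m: "1 \<le> m" "m \<le> n"
  shows "real n - real m - 1 - real n * log 2 (real n) / real m \<le> real_of_int k"
proof -
  \<comment> \<open>Infinitely many available vertices guarantee a vertex set of every size
    \<open>n\<close>.\<close>
  obtain V :: "'a set" where V: "finite V" "card V = n"
    using infinite_arbitrarily_large[OF infinite_UNIV] by blast
  obtain A where A: "A \<subseteq> V" "card A = m"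
    using obtain_subset_with_card_n[of m V] V m by metis
  have B: "card (V - A) = n - m"
    using V A by (simp add: card_Diff_subset finite_subset)
  \<comment> \<open>The edgeless graph shows that some label exists, so \<open>0 \<le> k\<close> and
    \<open>nat k\<close> can be turned back into \<open>k\<close>.\<close>
  have "bipartite_graph V {} \<in> n_vertex_graphs n"
    using bipartite_graph_in_n_vertex_graphs[OF V(1), of A "{}"] A V by auto
  moreover have "pverts (bipartite_graph V {}) \<noteq> {}"
    using V m by (auto simp: bipartite_graph_def)
  ultimately have "0 \<le> k"
    by (rule distance_vector_scheme_nonneg[OF scheme])
  have "(2::nat) ^ (m * (n - m)) \<le> fact n * (2 ^ Suc (nat k)) ^ m"
    using bipartite_counting[of V k A] scheme V A B by simp
  also have "\<dots> \<le> n ^ n * (2 ^ Suc (nat k)) ^ m"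
    using fact_le_power[of n, where 'a = nat] by (intro mult_right_mono) auto
  finally have "real (2 ^ (m * (n - m))) \<le> real (n ^ n * (2 ^ Suc (nat k)) ^ m)"
    by (rule of_nat_mono)
  then have "2 ^ (m * (n - m)) \<le> real n ^ n * 2 ^ (Suc (nat k) * m)"
    by (simp only: of_nat_mult of_nat_power of_nat_numeral power_mult)
  then have "log 2 (2 ^ (m * (n - m))) \<le> log 2 (real n ^ n * 2 ^ (Suc (nat k) * m))"
    using m by (subst log_le_cancel_iff) auto
  then have "real m * (real n - real m) \<le> real n * log 2 (real n) + (real_of_int k + 1) * real m"
    using m \<open>0 \<le> k\<close> by (simp add: log_mult log_nat_power of_nat_diff algebra_simps del: power_Suc)
  then show ?thesis
    using m by (simp add: field_simps)
qed

theorem theorem2p6: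
  fixes f :: "nat \<Rightarrow> int"
  assumes "\<And>n. n \<ge> 1 \<Longrightarrow>
    has_distance_vector_scheme (n_vertex_graphs n :: 'a::infinite pair_pre_digraph set) (f n)"
  shows "\<exists>\<epsilon> :: nat \<Rightarrow> real. \<epsilon> \<in> o(\<lambda>_. 1) \<and>
    (\<forall>n\<ge>1. real_of_int (f n) \<ge> (1 - \<epsilon> n) * real n)"
proof (intro exI conjI allI impI)
  \<comment> \<open>The numerator bounds the total loss \<open>m + 1 + n log n / m\<close>: the 2
    combines the \<open>- 1\<close> of the lower bound with the rounding in
    \<open>m \<le> sqrt n + 1\<close>.\<close>
  let ?\<epsilon> = "\<lambda>n::nat. (sqrt (real n) + 2 + sqrt (real n) * log 2 (real n)) / real n"
  show "?\<epsilon> \<in> o(\<lambda>_. 1)"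
    unfolding log_def by real_asymp
  fix n :: nat assume n: "1 \<le> n"
  \<comment> \<open>Both \<open>m\<close> and \<open>n log n / m\<close> must be
    \<open>o(n)\<close>, so \<open>m\<close> has to grow faster than \<open>log n\<close> and slower
    than \<open>n\<close>; the square root does both.\<close>
  define m where "m = nat \<lceil>sqrt (real n)\<rceil>"
  have sqrt_n: "1 \<le> sqrt (real n)" "sqrt (real n) \<le> real n"
    using n by (auto simp: real_le_rsqrt sqrt_le_D intro!: real_le_lsqrt self_le_power)
  then have m: "sqrt (real n) \<le> real m" "real m \<le> sqrt (real n) + 1" "m \<le> n"
    unfolding m_def by linarith+
  then have "1 \<le> m"
    using sqrt_n by linarith
  have "real n * log 2 (real n) / real m \<le> real n * log 2 (real n) / sqrt (real n)"
    using n m sqrt_n \<open>1 \<le> m\<close> by (intro divide_left_mono mult_nonneg_nonneg mult_pos_pos) auto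
  also have "\<dots> = sqrt (real n) * log 2 (real n)"
    using n by (simp add: field_simps flip: power2_eq_square)
  finally have "real n - sqrt (real n) - 2 - sqrt (real n) * log 2 (real n) \<le> real_of_int (f n)"
    using distance_vector_scheme_lower_bound[OF assms[OF n] \<open>1 \<le> m\<close> m(3)] m(2) by linarith
  moreover have "(1 - ?\<epsilon> n) * real n = real n - sqrt (real n) - 2 - sqrt (real n) * log 2 (real n)"
    using n by (simp add: left_diff_distrib)
  ultimately show "(1 - ?\<epsilon> n) * real n \<le> real_of_int (f n)"
    by simp
qed

end
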